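(* Let $G$ be a graph and $s$ an ordering of $V(G)$. In polynomial time one can compute a partition $\mathcal{V}$ of $V(G)$ into the minimum possible number $k$ of parts such that each part consists of vertices that are consecutive in $s$ and $s$ is consistent with $\mathcal{V}$. The same holds with "consistent" replaced by "strongly consistent".
   Context: An ordering $s$ of $V(G)$ is consistent with a partition $(V_1,\ldots,V_k)$ of $V(G)$ if for every triple $p,q,r$ with $p$ before $q$ before $r$ in $s$, whenever $p,q$ lie in the same part and $(p,r)\in E(G)$, then $(q,r)\in E(G)$. It is strongly consistent if it is consistent and moreover for every such triple, whenever $q,r$ lie in the same part and $(p,r)\in E(G)$, then $(p,q)\in E(G)$. A consistent (resp. strongly consistent) ordering in which the vertices of each part are consecutive is called precedence consistent (resp. precedence strongly consistent) with respect to the partition. *)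

theory Defs
  imports
    "Graph_Theory.Pair_Digraph"
    "HOL-Combinatorics.Multiset_Permutations"
    "HOL-Library.Disjoint_Sets"
    "HOL-Computational_Algebra.Polynomial"
begin

section \<open>Orderings and partitions\<close>

text \<open>
  An ordering of a finite set \<open>V\<close> is a list in \<^term>\<open>permutations_of_set V\<close>; a partition of \<open>V\<close> is a
  set of parts satisfying \<^term>\<open>partition_on V\<close>. A finite simple undirected graph is a
  \<^locale>\<open>pair_graph\<close>: \<^term>\<open>parcs G\<close> is finite, symmetric and irreflexive.
\<close>

definition before :: "'a list \<Rightarrow> 'a \<Rightarrow> 'a \<Rightarrow> bool" where
  "before s p q \<longleftrightarrow> (\<exists>i j. i < j \<and> j < length s \<and> s ! i = p \<and> s ! j = q)"

definition same_part :: "'a set set \<Rightarrow> 'a \<Rightarrow> 'a \<Rightarrow> bool" where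
  "same_part \<V> p q \<longleftrightarrow> (\<exists>X\<in>\<V>. p \<in> X \<and> q \<in> X)"

definition consistent :: "'a pair_pre_digraph \<Rightarrow> 'a list \<Rightarrow> 'a set set \<Rightarrow> bool" where
  "consistent G s \<V> \<longleftrightarrow>
     (\<forall>p q r. before s p q \<and> before s q r \<longrightarrow>
        same_part \<V> p q \<and> (p, r) \<in> parcs G \<longrightarrow> (q, r) \<in> parcs G)"

definition strongly_consistent :: "'a pair_pre_digraph \<Rightarrow> 'a list \<Rightarrow> 'a set set \<Rightarrow> bool" where
  "strongly_consistent G s \<V> \<longleftrightarrow> consistent G s \<V> \<and>
     (\<forall>p q r. before s p q \<and> before s q r \<longrightarrow>
        same_part \<V> q r \<and> (p, r) \<in> parcs G \<longrightarrow> (p, q) \<in> parcs G)"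

definition consecutive_in :: "'a list \<Rightarrow> 'a set \<Rightarrow> bool" where
  "consecutive_in s X \<longleftrightarrow>
     (\<forall>p q r. before s p q \<and> before s q r \<and> p \<in> X \<and> r \<in> X \<longrightarrow> q \<in> X)"

definition precedence_consistent :: "'a pair_pre_digraph \<Rightarrow> 'a list \<Rightarrow> 'a set set \<Rightarrow> bool" where
  "precedence_consistent G s \<V> \<longleftrightarrow> consistent G s \<V> \<and> (\<forall>X\<in>\<V>. consecutive_in s X)"

definition precedence_strongly_consistent ::
    "'a pair_pre_digraph \<Rightarrow> 'a list \<Rightarrow> 'a set set \<Rightarrow> bool" where
  "precedence_strongly_consistent G s \<V> \<longleftrightarrow>
     strongly_consistent G s \<V> \<and> (\<forall>X\<in>\<V>. consecutive_in s X)"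


section \<open>Polynomial-time computation\<close>

text \<open>
  The machine model is a random access machine over the natural numbers, programmed in a structured
  language. A state consists of the registers and the memory. A step is one node of an expression
  or one command. As addition is the only operation that can enlarge a number, a computation of
  \<open>t\<close> steps produces only numbers with at most \<open>t\<close> bits more than the largest number in the input
  and the program. This makes the unit-cost measure polynomially related to the running time of
  Turing machines; a multiplication instruction would break this.
\<close>

datatype expr =
    Const nat
  | Reg nat
  | Mem expr
  | Add expr expr
  | Sub expr expr

datatype com =
    Skip
  | Assign nat expr
  | Store expr expr
  | Seq com com
  | Cond expr com com
  | While expr com

type_synonym state = "(nat \<Rightarrow> nat) \<times> (nat \<Rightarrow> nat)"

fun val :: "expr \<Rightarrow> state \<Rightarrow> nat" where
  "val (Const k) \<sigma> = k"
| "val (Reg x) \<sigma> = fst \<sigma> x"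
| "val (Mem a) \<sigma> = snd \<sigma> (val a \<sigma>)"
| "val (Add a b) \<sigma> = val a \<sigma> + val b \<sigma>"
| "val (Sub a b) \<sigma> = val a \<sigma> - val b \<sigma>"

fun cost :: "expr \<Rightarrow> nat" where
  "cost (Const k) = 1"
| "cost (Reg x) = 1"
| "cost (Mem a) = 1 + cost a"
| "cost (Add a b) = 1 + cost a + cost b"
| "cost (Sub a b) = 1 + cost a + cost b"

text \<open>
  \<open>exec c \<sigma> t \<tau>\<close>: started in state \<open>\<sigma>\<close>, the program \<open>c\<close> halts after \<open>t\<close> steps in state \<open>\<tau>\<close>.
  A condition counts as true iff its value is nonzero.
\<close>

inductive exec :: "com \<Rightarrow> state \<Rightarrow> nat \<Rightarrow> state \<Rightarrow> bool" where
  Skip: "exec Skip \<sigma> 1 \<sigma>"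
| Assign: "exec (Assign x a) \<sigma> (1 + cost a) ((fst \<sigma>)(x := val a \<sigma>), snd \<sigma>)"
| Store: "exec (Store a b) \<sigma> (1 + cost a + cost b) (fst \<sigma>, (snd \<sigma>)(val a \<sigma> := val b \<sigma>))"
| Seq: "exec c \<sigma> t \<rho> \<Longrightarrow> exec d \<rho> u \<tau> \<Longrightarrow> exec (Seq c d) \<sigma> (1 + t + u) \<tau>"
| CondTrue: "val a \<sigma> \<noteq> 0 \<Longrightarrow> exec c \<sigma> t \<tau> \<Longrightarrow> exec (Cond a c d) \<sigma> (1 + cost a + t) \<tau>"
| CondFalse: "val a \<sigma> = 0 \<Longrightarrow> exec d \<sigma> t \<tau> \<Longrightarrow> exec (Cond a c d) \<sigma> (1 + cost a + t) \<tau>"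
| WhileTrue: "val a \<sigma> \<noteq> 0 \<Longrightarrow> exec c \<sigma> t \<rho> \<Longrightarrow> exec (While a c) \<rho> u \<tau> \<Longrightarrow>
    exec (While a c) \<sigma> (1 + cost a + t + u) \<tau>"
| WhileFalse: "val a \<sigma> = 0 \<Longrightarrow> exec (While a c) \<sigma> (1 + cost a) \<sigma>"

inductive_cases exec_SkipE: "exec Skip \<sigma> t \<tau>"
inductive_cases exec_AssignE: "exec (Assign x a) \<sigma> t \<tau>"
inductive_cases exec_StoreE: "exec (Store a b) \<sigma> t \<tau>"
inductive_cases exec_SeqE: "exec (Seq c d) \<sigma> t \<tau>"
inductive_cases exec_CondE: "exec (Cond a c d) \<sigma> t \<tau>"
inductive_cases exec_WhileE: "exec (While a c) \<sigma> t \<tau>"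

lemma exec_deterministic:
  "exec c \<sigma> t \<tau> \<Longrightarrow> exec c \<sigma> t' \<tau>' \<Longrightarrow> t' = t \<and> \<tau>' = \<tau>"
proof (induction arbitrary: t' \<tau>' rule: exec.induct)
  case (Skip \<sigma>)
  from Skip.prems show ?case by (rule exec_SkipE) simp
next
  case (Assign x a \<sigma>)
  from Assign.prems show ?case by (rule exec_AssignE) simp
next
  case (Store a b \<sigma>)
  from Store.prems show ?case by (rule exec_StoreE) simp
next
  case (Seq c \<sigma> t \<rho> d u \<tau>)
  from Seq.prems obtain t1 \<rho>1 u1 where
    "exec c \<sigma> t1 \<rho>1" "exec d \<rho>1 u1 \<tau>'" "t' = 1 + t1 + u1"
    by (rule exec_SeqE) simp
  with Seq.IH show ?case by blast
next
  case (CondTrue a \<sigma> c t \<tau> d)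
  with CondTrue.prems obtain t1 where "exec c \<sigma> t1 \<tau>'" "t' = 1 + cost a + t1"
    by (auto elim: exec_CondE)
  with CondTrue.IH show ?case by blast
next
  case (CondFalse a \<sigma> d t \<tau> c)
  with CondFalse.prems obtain t1 where "exec d \<sigma> t1 \<tau>'" "t' = 1 + cost a + t1"
    by (auto elim: exec_CondE)
  with CondFalse.IH show ?case by blast
next
  case (WhileTrue a \<sigma> c t \<rho> u \<tau>)
  from WhileTrue.prems obtain t1 \<rho>1 u1 where
    "exec c \<sigma> t1 \<rho>1" "exec (While a c) \<rho>1 u1 \<tau>'" "t' = 1 + cost a + t1 + u1"
    by (rule exec_WhileE) (use WhileTrue.hyps in simp_all)
  with WhileTrue.IH show ?case by blast
next
  case (WhileFalse a \<sigma> c)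
  from WhileFalse.prems show ?case by (rule exec_WhileE) (use WhileFalse.hyps in simp_all)
qed

text \<open>
  Words are lists of numbers, stored from memory cell 0 on with their length in register 0. At the
  start all other registers and memory cells are 0; at the end they are arbitrary.
\<close>

definition initial_state :: "nat list \<Rightarrow> state" where
  "initial_state xs = ((\<lambda>_. 0)(0 := length xs), (\<lambda>i. if i < length xs then xs ! i else 0))"

definition output_word :: "state \<Rightarrow> nat list" where
  "output_word \<tau> = map (snd \<tau>) [0..<fst \<tau> 0]"

text \<open>
  A single program finds, for every instance in \<open>I\<close>, some word that solves it, in a number of steps
  polynomial in the length of the encoded instance. The encoding used below only contains numbers
  that are at most the length of the word, so that this length is polynomially related to the
  number of bits.
\<close>

definition poly_time_solvable ::
    "'i set \<Rightarrow> ('i \<Rightarrow> nat list) \<Rightarrow> ('i \<Rightarrow> nat list \<Rightarrow> bool) \<Rightarrow> bool" where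
  "poly_time_solvable I code solves \<longleftrightarrow>
     (\<exists>c (b :: nat poly). \<forall>x\<in>I. \<exists>t \<tau>.
        exec c (initial_state (code x)) t \<tau> \<and>
        t \<le> poly b (length (code x)) \<and>
        solves x (output_word \<tau>))"


section \<open>Graphs with an ordering as input, partitions as output\<close>

text \<open>
  An instance \<open>(G, vs, s)\<close> consists of a graph \<open>G\<close>, an arbitrary numbering \<open>vs\<close> of its vertices by
  \<open>0, \<dots>, n - 1\<close>, which only serves to represent the graph, and the given ordering \<open>s\<close>. It is
  encoded as \<open>n\<close>, followed by the adjacency matrix row by row, followed by the numbers of the
  vertices in the sequence \<open>s\<close>.
\<close>

type_synonym 'a ordered_graph = "'a pair_pre_digraph \<times> 'a list \<times> 'a list"

definition ordered_graphs :: "'a ordered_graph set" where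
  "ordered_graphs = {(G, vs, s). pair_graph G \<and>
     vs \<in> permutations_of_set (pverts G) \<and> s \<in> permutations_of_set (pverts G)}"

definition vertex_number :: "'a list \<Rightarrow> 'a \<Rightarrow> nat" where
  "vertex_number vs = inv_into {..<length vs} ((!) vs)"

fun ordered_graph_code :: "'a ordered_graph \<Rightarrow> nat list" where
  "ordered_graph_code (G, vs, s) =
     length vs # [of_bool ((u, v) \<in> parcs G). u \<leftarrow> vs, v \<leftarrow> vs] @ map (vertex_number vs) s"

text \<open>
  A partition with \<open>k\<close> parts is output as \<open>k\<close>, followed by the label in \<open>{..<k}\<close> of the part
  containing vertex number \<open>i\<close>, for each \<open>i\<close>.
\<close>

definition codes_partition :: "'a list \<Rightarrow> 'a set set \<Rightarrow> nat list \<Rightarrow> bool" where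
  "codes_partition vs \<V> ys \<longleftrightarrow>
     (\<exists>k ls. ys = k # ls \<and> length ls = length vs \<and> set ls \<subseteq> {..<k} \<and> k = card \<V> \<and>
        \<V> = (\<lambda>j. {vs ! i |i. i < length vs \<and> ls ! i = j}) ` {..<k})"

text \<open>
  The word codes a partition with property \<open>P\<close> that has the minimum number of parts among all
  partitions of the vertex set with property \<open>P\<close>.
\<close>

fun codes_minimum_partition ::
    "('a pair_pre_digraph \<Rightarrow> 'a list \<Rightarrow> 'a set set \<Rightarrow> bool) \<Rightarrow> 'a ordered_graph \<Rightarrow> nat list \<Rightarrow> bool"
where
  "codes_minimum_partition P (G, vs, s) ys \<longleftrightarrow>
     (\<exists>\<V>. is_arg_min card (\<lambda>\<W>. partition_on (pverts G) \<W> \<and> P G s \<W>) \<V> \<and>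
        codes_partition vs \<V> ys)"

end

theory Submission
  imports Defs
begin

text \<open>
  Since the parts are intervals of \<open>s\<close>, consistency can be propagated along neighbours: it holds iff
  it holds for the pairs of successive vertices that share a part. Whether two successive vertices
  may share a part is therefore independent of the rest of the partition, and a minimum partition
  arises by cutting exactly where they may not. The program tests every successive pair by comparing
  two rows of the adjacency matrix; by the symmetry of the matrix, rows also suffice for
  the strong version.
\<close>

section \<open>Cutting an ordering\<close>

text \<open>Why neighbours suffice: for a fixed \<open>r\<close> behind a part, consistency says
  that adjacency to \<open>r\<close> passes from each vertex of the part to all later ones; for a
  fixed \<open>r\<close> in front of it, the strong version says that adjacency to \<open>r\<close>
  passes to all earlier ones. Such implications compose along successive pairs, and a part that is
  an interval contains all intermediate vertices. Why cutting is optimal: an interval containing two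
  cuts would contain the predecessor of the later one, so every part contains at most one cut.
  \<open>cut\<close> takes a bare relation between positions, so that the graph side
  (\<open>ordering\<close>) and the machine side (\<open>encoding\<close>), which knows no graph,
  meet in the same predicate. The machine offers neither products nor comparisons. Row addresses
  arise by repeated addition, which for each position costs no more than a constant times
  \<open>n + 1\<close>, just as the scan of two rows does; comparisons are truncated
  subtractions.\<close>

text \<open>\<open>A i j\<close> says that the vertices at positions \<open>i\<close> and \<open>j\<close> of the ordering are adjacent; \<open>st\<close>
  selects the strong version. The position \<open>0\<close> counts as a cut, so that cuts correspond to parts.\<close>

definition cut :: "bool \<Rightarrow> nat \<Rightarrow> (nat \<Rightarrow> nat \<Rightarrow> bool) \<Rightarrow> nat \<Rightarrow> bool" where
  "cut st n A i \<longleftrightarrow> i = 0 \<or>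
     (\<exists>r<n. (i < r \<and> A (i - 1) r \<and> \<not> A i r) \<or> (st \<and> r < i - 1 \<and> A i r \<and> \<not> A (i - 1) r))"

section \<open>Counting the cuts before a position\<close>

definition count :: "(nat \<Rightarrow> bool) \<Rightarrow> nat \<Rightarrow> nat" where
  "count c i = card {j. j < i \<and> c j}"

lemma count_0 [simp]: "count c 0 = 0"
  by (simp add: count_def)

lemma count_Suc [simp]: "count c (Suc i) = (if c i then Suc (count c i) else count c i)"
proof -
  have "{j. j < Suc i \<and> c j} = (if c i then insert i {j. j < i \<and> c j} else {j. j < i \<and> c j})"
    by (auto simp: less_Suc_eq)
  then show ?thesis
    by (simp add: count_def)
qed

lemma count_mono: "i \<le> j \<Longrightarrow> count c i \<le> count c j"
  unfolding count_def by (rule card_mono) auto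

lemma count_pos: "c 0 \<Longrightarrow> 0 < count c (Suc i)"
  using count_mono[of 1 "Suc i" c] by simp

text \<open>A discrete intermediate value argument: the count starts at 0 and rises by at most 1 per
  position. It makes every block nonempty.\<close>

lemma count_surj: "j < count c n \<Longrightarrow> \<exists>i<n. count c (Suc i) = Suc j"
proof (induction n)
  case (Suc n)
  then show ?case
    by (cases "j < count c n") (auto split: if_splits simp: less_Suc_eq)
qed simp

lemma count_eq_imp_not:
  assumes "count c (Suc i) = count c (Suc k)" "i < j" "j \<le> k"
  shows "\<not> c j"
proof
  assume "c j"
  then have "count c (Suc j) = Suc (count c j)"
    by simp
  moreover have "count c (Suc i) \<le> count c j" "count c (Suc j) \<le> count c (Suc k)"
    using assms(2,3) by (simp_all add: count_mono del: count_Suc)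
  ultimately show False
    using assms(1) by linarith
qed

lemma before_nth:
  assumes "distinct s" "i < length s" "j < length s"
  shows "before s (s ! i) (s ! j) \<longleftrightarrow> i < j"
  using assms unfolding before_def by (metis less_trans nth_eq_iff_index_eq)

text \<open>Distinctness identifies the two positions at which \<open>q\<close> is found; otherwise
  the positions of \<open>p\<close> and \<open>r\<close> could not be compared.\<close>

lemma before_cases:
  assumes "before s p q" "before s q r" "distinct s"
  obtains i j k where "i < j" "j < k" "k < length s" "p = s ! i" "q = s ! j" "r = s ! k"
proof -
  from assms(1) obtain i j where 1: "i < j" "j < length s" "p = s ! i" "q = s ! j"
    unfolding before_def by blast
  from assms(2) obtain j' k where 2: "j' < k" "k < length s" "q = s ! j'" "r = s ! k"
    unfolding before_def by blast
  have "j' = j"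
    using 1 2 assms(3) by (metis less_trans nth_eq_iff_index_eq)
  with 1 2 show thesis
    by (intro that[of i j k]) auto
qed

section \<open>The local criterion for consistency\<close>

definition prec :: "bool \<Rightarrow> 'a pair_pre_digraph \<Rightarrow> 'a list \<Rightarrow> 'a set set \<Rightarrow> bool" where
  "prec st = (if st then precedence_strongly_consistent else precedence_consistent)"

locale ordering =
  fixes G :: "'a pair_pre_digraph" and s :: "'a list" and st :: bool
  assumes graph: "pair_graph G" and s: "s \<in> permutations_of_set (pverts G)"
begin

abbreviation "n \<equiv> length s"
abbreviation "A i j \<equiv> (s ! i, s ! j) \<in> parcs G"
abbreviation "C \<equiv> cut st n (\<lambda>i j. A i j)"

lemma dist: "distinct s" and set_s: "set s = pverts G"
  using s by (auto simp: permutations_of_set_def)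

lemma A_sym: "A i j \<longleftrightarrow> A j i"
proof -
  interpret pair_graph G by (rule graph)
  show ?thesis using arcs_symmetric by blast
qed

text \<open>The witness \<open>r\<close> of a cut completes the successive pair to a violating
  triple: it comes after the pair in the first disjunct and before it in the second.\<close>

lemma prec_imp_no_cut:
  assumes "prec st G s \<V>" "same_part \<V> (s ! i) (s ! Suc i)" "Suc i < n"
  shows "\<not> C (Suc i)"
proof
  assume "C (Suc i)"
  then obtain r where r: "r < n"
    "(Suc i < r \<and> A i r \<and> \<not> A (Suc i) r) \<or> (st \<and> r < i \<and> A (Suc i) r \<and> \<not> A i r)"
    by (auto simp: cut_def)
  have con: "consistent G s \<V>" and str: "st \<Longrightarrow> strongly_consistent G s \<V>"
    using assms(1)
    by (auto simp: prec_def precedence_consistent_def precedence_strongly_consistent_def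
        strongly_consistent_def split: if_splits)
  from r(2) show False
  proof
    assume "Suc i < r \<and> A i r \<and> \<not> A (Suc i) r"
    moreover from this have "before s (s ! i) (s ! Suc i)" "before s (s ! Suc i) (s ! r)"
      using assms(3) r(1) dist by (simp_all add: before_nth)
    ultimately show False
      using con assms(2) unfolding consistent_def by blast
  next
    assume *: "st \<and> r < i \<and> A (Suc i) r \<and> \<not> A i r"
    \<comment> \<open>The cut test reads the rows of the pair, while the triple starts at
      \<open>r\<close>; symmetry of the graph mediates.\<close>
    then have "A r (Suc i)" "\<not> A r i"
      using A_sym by blast+
    moreover have "before s (s ! r) (s ! i)" "before s (s ! i) (s ! Suc i)"
      using * assms(3) dist by (simp_all add: before_nth)
    ultimately show False
      using * str assms(2) unfolding strongly_consistent_def by blast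
  qed
qed

lemma consecutive_between:
  assumes "consecutive_in s X" "s ! i \<in> X" "s ! k \<in> X" "i \<le> j" "j \<le> k" "k < n"
  shows "s ! j \<in> X"
proof (cases "i = j \<or> j = k")
  case False
  then have "before s (s ! i) (s ! j)" "before s (s ! j) (s ! k)"
    using assms dist by (auto simp: before_nth)
  then show ?thesis
    using assms unfolding consecutive_in_def by blast
qed (use assms in auto)

lemma not_cutD:
  assumes "\<not> C (Suc i)" "r < n"
  shows "Suc i < r \<Longrightarrow> A i r \<Longrightarrow> A (Suc i) r"
    and "st \<Longrightarrow> r < i \<Longrightarrow> A (Suc i) r \<Longrightarrow> A i r"
  using assms unfolding cut_def diff_Suc_1 by blast+

lemma no_cut_imp_prec:
  assumes cons: "\<And>X. X \<in> \<V> \<Longrightarrow> consecutive_in s X"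
    and no_cut: "\<And>i. Suc i < n \<Longrightarrow> same_part \<V> (s ! i) (s ! Suc i) \<Longrightarrow> \<not> C (Suc i)"
  shows "prec st G s \<V>"
proof -
  have no_cut': "\<not> C (Suc l)"
    if "same_part \<V> (s ! i) (s ! j)" "i \<le> l" "Suc l \<le> j" "j < n" for i j l
  proof -
    from that(1) obtain X where X: "X \<in> \<V>" "s ! i \<in> X" "s ! j \<in> X"
      by (auto simp: same_part_def)
    have "s ! l \<in> X" "s ! Suc l \<in> X"
      using consecutive_between[OF cons[OF X(1)] X(2,3)] that by auto
    with X(1) have "same_part \<V> (s ! l) (s ! Suc l)"
      by (auto simp: same_part_def)
    with no_cut that show ?thesis by auto
  qed
  have con: "consistent G s \<V>"
    unfolding consistent_def
  proof (intro allI impI, elim conjE)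
    fix p q r
    assume *: "before s p q" "before s q r" "same_part \<V> p q" "(p, r) \<in> parcs G"
    from before_cases[OF *(1,2) dist] obtain i j k where
      ijk: "i < j" "j < k" "k < n" "p = s ! i" "q = s ! j" "r = s ! k" .
    \<comment> \<open>Adjacency to the fixed \<open>k\<close> moves forward from \<open>i\<close> to
      \<open>j\<close>. Each new position is at most \<open>j\<close>, hence before
      \<open>k\<close>, as the cut test demands.\<close>
    have "A l k" if "i \<le> l" "l \<le> j" for l
      using that
    proof (induction l rule: dec_induct)
      case base
      then show ?case using * ijk by simp
    next
      case (step l)
      then have "\<not> C (Suc l)"
        using no_cut'[of i j l] * ijk by simp
      from not_cutD(1)[OF this \<open>k < n\<close>] show ?case
        using step ijk by simp
    qed
    then show "(q, r) \<in> parcs G"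
      using ijk by auto
  qed
  have str: "(p, q) \<in> parcs G"
    if st and *: "before s p q" "before s q r" "same_part \<V> q r" "(p, r) \<in> parcs G" for p q r
  proof -
    from before_cases[OF *(1,2) dist] obtain i j k where
      ijk: "i < j" "j < k" "k < n" "p = s ! i" "q = s ! j" "r = s ! k" .
    from ijk(2) have "j \<le> k" by simp
    \<comment> \<open>This chain runs backwards from \<open>k\<close> to \<open>j\<close>, with
      \<open>i\<close> fixed in front. The goal is \<open>A j i\<close> rather than
      \<open>A i j\<close> because \<open>cut\<close> compares rows.\<close>
    then have "A j i"
    proof (induction j rule: inc_induct)
      case base
      then show ?case using * ijk A_sym by simp
    next
      case (step l)
      then have "\<not> C (Suc l)"
        using no_cut'[of j k l] * ijk by simp
      from not_cutD(2)[OF this, of i] show ?case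
        using step ijk \<open>st\<close> by simp
    qed
    then show ?thesis
      using ijk A_sym by simp
  qed
  show ?thesis
    using con str cons
    by (auto simp: prec_def precedence_consistent_def precedence_strongly_consistent_def
        strongly_consistent_def)
qed

section \<open>Lower bound on the number of parts\<close>

lemma count_le_card:
  assumes part: "partition_on (pverts G) \<W>" and prec: "prec st G s \<W>"
  shows "count C n \<le> card \<W>"
proof -
  have cons: "consecutive_in s X" if "X \<in> \<W>" for X
    using prec that
    by (auto simp: prec_def precedence_consistent_def precedence_strongly_consistent_def
        split: if_splits)
  have "\<forall>i\<in>{i. i < n \<and> C i}. \<exists>X. X \<in> \<W> \<and> s ! i \<in> X"
    using part set_s by (auto simp: partition_on_def dest!: nth_mem)
  then obtain f where f: "\<And>i. i < n \<Longrightarrow> C i \<Longrightarrow> f i \<in> \<W> \<and> s ! i \<in> f i"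
    by (metis (mono_tags, lifting) mem_Collect_eq)
  \<comment> \<open>The contradiction comes from the later cut \<open>j\<close>, whose predecessor
    \<open>l\<close> is caught in the part between \<open>i\<close> and \<open>j\<close>. Position
    0, a cut only by convention, can occur only as \<open>i\<close>.\<close>
  have less: False if "i < j" "j < n" "C i" "C j" "f i = f j" for i j
  proof -
    from \<open>i < j\<close> obtain l where l: "j = Suc l" "i \<le> l"
      by (cases j) auto
    have X: "f i \<in> \<W>" "s ! i \<in> f i" "s ! j \<in> f i"
      using f[of i] f[of j] that by auto
    have "s ! l \<in> f i"
      using consecutive_between[OF cons[OF X(1)] X(2,3), of l] l that by auto
    then have "same_part \<W> (s ! l) (s ! Suc l)"
      using X l by (auto simp: same_part_def)
    then show False
      using prec_imp_no_cut[OF prec, of l] that l by auto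
  qed
  have inj: "inj_on f {i. i < n \<and> C i}"
    by (rule inj_onI) (metis (mono_tags, lifting) less linorder_neqE_nat mem_Collect_eq)
  \<comment> \<open>\<open>card\<close> of an infinite set is 0, so injectivity alone would give no
    bound.\<close>
  have "finite \<W>"
    by (rule finite_elements[OF _ part]) (simp flip: set_s)
  then show ?thesis
    unfolding count_def using inj f by (intro card_inj_on_le) auto
qed

section \<open>The blocks between cuts attain the bound\<close>

definition block :: "nat \<Rightarrow> 'a set" where
  "block j = {s ! i |i. i < n \<and> count C (Suc i) = Suc j}"

definition blocks :: "'a set set" where
  "blocks = block ` {..<count C n}"

text \<open>The count up to and including position \<open>i\<close> is at least 1 because position 0
  is a cut; subtracting 1 gives the label range that \<open>codes_partition\<close>
  prescribes.\<close>

lemma label_less: "i < n \<Longrightarrow> count C (Suc i) - 1 < count C n"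
  using count_pos[of C i] count_mono[of "Suc i" n C] by (simp add: cut_def del: count_Suc)

lemma nth_mem_block:
  "i < n \<Longrightarrow> s ! i \<in> block j \<longleftrightarrow> count C (Suc i) = Suc j"
  using dist by (auto simp: block_def nth_eq_iff_index_eq simp del: count_Suc)

lemma block_nonempty: "j < count C n \<Longrightarrow> block j \<noteq> {}"
  using count_surj[of j C n] by (auto simp: block_def simp del: count_Suc)

lemma block_subset: "block j \<subseteq> set s"
  by (auto simp: block_def)

lemma block_disjoint:
  assumes "j \<noteq> k"
  shows "block j \<inter> block k = {}"
proof -
  have "x \<notin> block k" if "x \<in> block j" for x
  proof -
    from that block_subset obtain i where "i < n" "x = s ! i"
      by (metis in_set_conv_nth subsetD)
    with that assms show ?thesis
      by (simp add: nth_mem_block del: count_Suc)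
  qed
  then show ?thesis by blast
qed

lemma inj_on_block: "inj_on block {..<count C n}"
  by (rule inj_onI) (metis block_disjoint block_nonempty inf.idem lessThan_iff)

lemma card_blocks: "card blocks = count C n"
  unfolding blocks_def by (simp add: card_image inj_on_block)

lemma partition_on_blocks: "partition_on (pverts G) blocks"
proof (rule partition_onI)
  have "x \<in> \<Union> blocks" if "x \<in> set s" for x
  proof -
    from that obtain i where i: "i < n" "x = s ! i"
      by (auto simp: in_set_conv_nth)
    then have "x \<in> block (count C (Suc i) - 1)"
      using count_pos[of C i] by (simp add: nth_mem_block cut_def del: count_Suc)
    then show ?thesis
      using label_less[OF i(1)] by (auto simp: blocks_def simp del: count_Suc)
  qed
  then show "\<Union> blocks = pverts G"
    using block_subset by (auto simp: blocks_def simp flip: set_s)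
  show "{} \<notin> blocks"
    using block_nonempty by (force simp: blocks_def)
  fix p q assume "p \<in> blocks" "q \<in> blocks" "p \<noteq> q"
  moreover from this obtain j k where "p = block j" "q = block k"
    by (auto simp: blocks_def)
  ultimately show "disjnt p q"
    using block_disjoint[of j k] by (auto simp: disjnt_def)
qed

lemma prec_blocks: "prec st G s blocks"
proof (rule no_cut_imp_prec)
  fix X assume "X \<in> blocks"
  then obtain l where X: "X = block l" by (auto simp: blocks_def)
  show "consecutive_in s X"
    unfolding consecutive_in_def
  proof (intro allI impI, elim conjE)
    fix p q r
    assume *: "before s p q" "before s q r" "p \<in> X" "r \<in> X"
    from before_cases[OF *(1,2) dist] obtain i j k where
      ijk: "i < j" "j < k" "k < n" "p = s ! i" "q = s ! j" "r = s ! k" .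
    then have "count C (Suc i) = Suc l" "count C (Suc k) = Suc l"
      using * X nth_mem_block by (auto simp del: count_Suc)
    moreover have "count C (Suc i) \<le> count C (Suc j)" "count C (Suc j) \<le> count C (Suc k)"
      using ijk by (auto intro!: count_mono simp del: count_Suc)
    ultimately show "q \<in> X"
      using ijk X nth_mem_block by (simp del: count_Suc)
  qed
next
  fix i assume *: "Suc i < n" "same_part blocks (s ! i) (s ! Suc i)"
  then obtain j where "s ! i \<in> block j" "s ! Suc i \<in> block j"
    by (auto simp: same_part_def blocks_def)
  then have "count C (Suc i) = count C (Suc (Suc i))"
    using * nth_mem_block by (simp del: count_Suc)
  then show "\<not> C (Suc i)"
    by (rule count_eq_imp_not) auto
qed

lemma is_arg_min_blocks:
  "is_arg_min card (\<lambda>\<W>. partition_on (pverts G) \<W> \<and> prec st G s \<W>) blocks"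
  using partition_on_blocks prec_blocks count_le_card
  by (auto simp: is_arg_min_def card_blocks not_less)

end


section \<open>Programs with a time bound\<close>

definition runs :: "com \<Rightarrow> state \<Rightarrow> nat \<Rightarrow> (state \<Rightarrow> bool) \<Rightarrow> bool" where
  "runs c \<sigma> T Q \<longleftrightarrow> (\<exists>t \<tau>. exec c \<sigma> t \<tau> \<and> t \<le> T \<and> Q \<tau>)"

lemma runs_mono:
  "runs c \<sigma> T Q \<Longrightarrow> T \<le> T' \<Longrightarrow> (\<And>\<tau>. Q \<tau> \<Longrightarrow> Q' \<tau>) \<Longrightarrow> runs c \<sigma> T' Q'"
  unfolding runs_def by (meson order_trans)

lemma runs_Seq:
  assumes "runs c \<sigma> T R" "\<And>\<rho>. R \<rho> \<Longrightarrow> runs d \<rho> U Q"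
  shows "runs (Seq c d) \<sigma> (1 + T + U) Q"
proof -
  from assms(1) obtain t \<rho> where 1: "exec c \<sigma> t \<rho>" "t \<le> T" "R \<rho>"
    unfolding runs_def by blast
  from assms(2)[OF 1(3)] obtain u \<tau> where 2: "exec d \<rho> u \<tau>" "u \<le> U" "Q \<tau>"
    unfolding runs_def by blast
  have "1 + t + u \<le> 1 + T + U"
    using 1(2) 2(2) by simp
  then show ?thesis
    using exec.Seq[OF 1(1) 2(1)] 2(3) unfolding runs_def by blast
qed

text \<open>The variant \<open>f\<close> bounds the number of iterations, each costing at most the
  guard plus \<open>T\<close>; the additional 1 pays for the final failing test. \<open>T\<close> is
  uniform over all iterations, so the bounds of nested loops multiply.\<close>

lemma runs_While:
  assumes "I \<sigma>"
    and "\<And>\<sigma>. I \<sigma> \<Longrightarrow> val a \<sigma> \<noteq> 0 \<Longrightarrow> runs c \<sigma> T (\<lambda>\<tau>. I \<tau> \<and> f \<tau> < f \<sigma>)"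
    and "\<And>\<tau>. I \<tau> \<Longrightarrow> val a \<tau> = 0 \<Longrightarrow> Q \<tau>"
  shows "runs (While a c) \<sigma> ((f \<sigma> + 1) * (1 + cost a + T)) Q"
  using assms(1)
proof (induction "f \<sigma>" arbitrary: \<sigma> rule: less_induct)
  case less
  show ?case
  proof (cases "val a \<sigma> = 0")
    case True
    have "1 + cost a \<le> (f \<sigma> + 1) * (1 + cost a + T)"
      by simp
    moreover have "exec (While a c) \<sigma> (1 + cost a) \<sigma>"
      using True by (rule exec.WhileFalse)
    ultimately show ?thesis
      using assms(3)[OF less.prems True] unfolding runs_def by blast
  next
    case False
    from assms(2)[OF less.prems False] obtain t \<rho> where
      1: "exec c \<sigma> t \<rho>" "t \<le> T" "I \<rho>" "f \<rho> < f \<sigma>"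
      unfolding runs_def by blast
    from less.hyps[OF 1(4,3)] obtain u \<tau> where
      2: "exec (While a c) \<rho> u \<tau>" "u \<le> (f \<rho> + 1) * (1 + cost a + T)" "Q \<tau>"
      unfolding runs_def by blast
    have "(f \<rho> + 1) * (1 + cost a + T) \<le> f \<sigma> * (1 + cost a + T)"
      using 1(4) by (intro mult_right_mono) auto
    then have "1 + cost a + t + u \<le> (f \<sigma> + 1) * (1 + cost a + T)"
      using 1(2) 2(2) by simp
    moreover have "exec (While a c) \<sigma> (1 + cost a + t + u) \<tau>"
      using False 1(1) 2(1) by (rule exec.WhileTrue)
    ultimately show ?thesis
      using 2(3) unfolding runs_def by blast
  qed
qed

section \<open>Loop-free programs\<close>

fun straight :: "com \<Rightarrow> bool" where
  "straight (Seq c d) \<longleftrightarrow> straight c \<and> straight d"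
| "straight (Cond a c d) \<longleftrightarrow> straight c \<and> straight d"
| "straight (While a c) \<longleftrightarrow> False"
| "straight _ \<longleftrightarrow> True"

text \<open>For \<open>While\<close> the values of \<open>sem\<close> and \<open>time\<close> are irrelevant.\<close>

fun sem :: "com \<Rightarrow> state \<Rightarrow> state" where
  "sem (Assign x a) \<sigma> = ((fst \<sigma>)(x := val a \<sigma>), snd \<sigma>)"
| "sem (Store a b) \<sigma> = (fst \<sigma>, (snd \<sigma>)(val a \<sigma> := val b \<sigma>))"
| "sem (Seq c d) \<sigma> = sem d (sem c \<sigma>)"
| "sem (Cond a c d) \<sigma> = (if val a \<sigma> \<noteq> 0 then sem c \<sigma> else sem d \<sigma>)"
| "sem _ \<sigma> = \<sigma>"

fun time :: "com \<Rightarrow> nat" where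
  "time (Assign x a) = 1 + cost a"
| "time (Store a b) = 1 + cost a + cost b"
| "time (Seq c d) = 1 + time c + time d"
| "time (Cond a c d) = 1 + cost a + time c + time d"
| "time _ = 1"

text \<open>Replaces derivations in \<open>exec\<close> by symbolic evaluation with the simplifier.
  \<open>time\<close> charges a conditional for both branches, which makes the bound independent of
  the state.\<close>

lemma runs_straight:
  assumes "straight c" "Q (sem c \<sigma>)"
  shows "runs c \<sigma> (time c) Q"
  using assms
proof (induction c arbitrary: \<sigma> Q)
  case (Seq c d)
  have "runs c \<sigma> (time c) (\<lambda>\<rho>. Q (sem d \<rho>))"
    using Seq.prems by (intro Seq.IH(1)) auto
  moreover have "runs d \<rho> (time d) Q" if "Q (sem d \<rho>)" for \<rho>
    using Seq.prems that by (intro Seq.IH(2)) auto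
  ultimately show ?case
    unfolding time.simps by (rule runs_Seq)
next
  case (Cond a c d)
  show ?case
  proof (cases "val a \<sigma> = 0")
    case True
    then have "runs d \<sigma> (time d) Q"
      using Cond.prems by (intro Cond.IH(2)) auto
    then obtain t \<tau> where "exec d \<sigma> t \<tau>" "t \<le> time d" "Q \<tau>"
      unfolding runs_def by blast
    with exec.CondFalse[OF True this(1), of c] show ?thesis
      unfolding runs_def by (intro exI[of _ "1 + cost a + t"] exI[of _ \<tau>]) simp
  next
    case False
    then have "runs c \<sigma> (time c) Q"
      using Cond.prems by (intro Cond.IH(1)) auto
    then obtain t \<tau> where "exec c \<sigma> t \<tau>" "t \<le> time c" "Q \<tau>"
      unfolding runs_def by blast
    with exec.CondTrue[OF False this(1), of d] show ?thesis
      unfolding runs_def by (intro exI[of _ "1 + cost a + t"] exI[of _ \<tau>]) simp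
  qed
next
  case Skip
  then show ?case
    by - (unfold runs_def, intro exI conjI, rule exec.Skip, simp_all)
next
  case (Assign x a)
  then show ?case
    by - (unfold runs_def, intro exI conjI, rule exec.Assign, simp_all)
next
  case (Store a b)
  then show ?case
    by - (unfold runs_def, intro exI conjI, rule exec.Store, simp_all)
qed simp


section \<open>The program\<close>

text \<open>
  Register 0 keeps the length of the input and 12 the number \<open>n\<close> of vertices. The main loop runs over
  the positions \<open>i\<close> of the ordering (register 2). Register 8 holds the number of the \<open>i\<close>-th vertex,
  3 the address of its row, 4 that of the row of its predecessor, 5 counts the cuts, 6 is the
  counter of inner loops and 7 flags a cut. The labels are first stored behind the input, as they
  would otherwise overwrite the matrix.
\<close>

definition row_step :: com where
  "row_step = Seq (Assign 3 (Add (Reg 3) (Reg 12))) (Assign 6 (Sub (Reg 6) (Const 1)))"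

definition row_prog :: com where
  "row_prog = Seq (Seq (Assign 3 (Const 1)) (Assign 6 (Reg 8))) (While (Reg 6) row_step)"

text \<open>Truncated subtraction serves as strict comparison, both of positions and of the 0/1
  entries of the two rows. The column is the number of the vertex at position \<open>Reg 6\<close>,
  looked up first.\<close>

definition scan_step :: "bool \<Rightarrow> com" where
  "scan_step st =
     Seq (Assign 9 (Mem (Add (Sub (Reg 0) (Reg 12)) (Reg 6))))
    (Seq (Assign 10 (Mem (Add (Reg 4) (Reg 9))))
    (Seq (Assign 11 (Mem (Add (Reg 3) (Reg 9))))
    (Seq (Cond (Sub (Reg 6) (Reg 2))
            (Cond (Sub (Reg 10) (Reg 11)) (Assign 7 (Const 1)) Skip) Skip)
    (Seq (Cond (if st then Sub (Sub (Reg 2) (Const 1)) (Reg 6) else Const 0)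
            (Cond (Sub (Reg 11) (Reg 10)) (Assign 7 (Const 1)) Skip) Skip)
         (Assign 6 (Add (Reg 6) (Const 1)))))))"

text \<open>Starting register 7 at \<open>1 - i\<close> raises the flag exactly at position 0,
  matching the convention in \<open>cut\<close>.\<close>

definition scan_prog :: "bool \<Rightarrow> com" where
  "scan_prog st =
     Seq (Seq (Assign 7 (Sub (Const 1) (Reg 2))) (Assign 6 (Const 0)))
         (While (Sub (Reg 12) (Reg 6)) (scan_step st))"

text \<open>The sequence fills the last \<open>n\<close> cells of the input; measuring from the end
  avoids computing \<open>n * n\<close>.\<close>

definition fetch :: com where
  "fetch = Assign 8 (Mem (Add (Sub (Reg 0) (Reg 12)) (Reg 2)))"

text \<open>The offset \<open>Reg 8\<close> arranges the labels by vertex number, the order in which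
  \<open>codes_partition\<close> expects them, and not by position.\<close>

definition finish :: com where
  "finish =
     Seq (Cond (Reg 7) (Assign 5 (Add (Reg 5) (Const 1))) Skip)
    (Seq (Store (Add (Reg 0) (Reg 8)) (Sub (Reg 5) (Const 1)))
    (Seq (Assign 4 (Reg 3))
         (Assign 2 (Add (Reg 2) (Const 1)))))"

definition main_step :: "bool \<Rightarrow> com" where
  "main_step st = Seq fetch (Seq row_prog (Seq (scan_prog st) finish))"

text \<open>The cells written have addresses at most \<open>n\<close>, below all cells read, so no
  label is lost before it is copied.\<close>

definition copy_step :: com where
  "copy_step = Seq (Store (Add (Reg 6) (Const 1)) (Mem (Add (Reg 0) (Reg 6))))
     (Assign 6 (Add (Reg 6) (Const 1)))"

definition main_prog :: "bool \<Rightarrow> com" where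
  "main_prog st =
     Seq (Assign 12 (Mem (Const 0)))
    (Seq (While (Sub (Reg 12) (Reg 2)) (main_step st))
    (Seq (Assign 6 (Const 0))
    (Seq (While (Sub (Reg 12) (Reg 6)) copy_step)
         (Seq (Store (Const 0) (Reg 5)) (Assign 0 (Add (Reg 12) (Const 1)))))))"

text \<open>\<open>num i\<close> is the number of the vertex at position \<open>i\<close> of the ordering.\<close>

locale encoding =
  fixes n :: nat and num :: "nat \<Rightarrow> nat" and A :: "nat \<Rightarrow> nat \<Rightarrow> bool" and st :: bool
  assumes num: "bij_betw num {..<n} {..<n}"
begin

abbreviation "N \<equiv> 1 + n * n + n"
abbreviation "cuts \<equiv> cut st n A"

section \<open>Correctness and running time of the program\<close>

text \<open>Matrix cells are addressed by vertex numbers but described through positions, the index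
  set of \<open>cut\<close>.\<close>

definition input :: "(nat \<Rightarrow> nat) \<Rightarrow> bool" where
  "input m \<longleftrightarrow> m 0 = n \<and> (\<forall>i<n. m (1 + n * n + i) = num i) \<and>
     (\<forall>i<n. \<forall>j<n. m (1 + num i * n + num j) = of_bool (A i j))"

lemma num_less: "i < n \<Longrightarrow> num i < n"
  using num by (auto simp: bij_betw_def)

lemma num_eq_iff: "i < n \<Longrightarrow> j < n \<Longrightarrow> num i = num j \<longleftrightarrow> i = j"
  using num by (auto simp: bij_betw_def inj_on_def)

lemma num_surj: "v < n \<Longrightarrow> \<exists>i<n. v = num i"
  using num by (auto simp: bij_betw_def)

lemma input_upd: "input m \<Longrightarrow> input (m(N + u := x))"
proof -
  assume m: "input m"
  have "1 + num i * n + num j < N" if "i < n" "j < n" for i j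
  proof -
    have "num i * n \<le> n * n"
      using num_less[OF that(1)] by (intro mult_right_mono) auto
    with num_less[OF that(2)] show ?thesis
      by linarith
  qed
  then have "1 + num i * n + num j \<noteq> N + u" if "i < n" "j < n" for i j
    using that by fastforce
  with m show ?thesis
    by (auto simp: input_def)
qed

lemma runs_row_prog:
  assumes "\<rho> 12 = n" "\<rho> 8 = u" "u \<le> n"
  shows "runs row_prog (\<rho>, m) (17 * (n + 1))
    (\<lambda>\<tau>. snd \<tau> = m \<and> fst \<tau> 3 = 1 + u * n \<and> (\<forall>x. x \<noteq> 3 \<and> x \<noteq> 6 \<longrightarrow> fst \<tau> x = \<rho> x))"
    (is "runs _ _ _ ?Q")
proof -
  \<comment> \<open>The address plus the rows still to be skipped is constant: register 6 counts the
    additions of \<open>n\<close> that remain.\<close>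
  let ?I = "\<lambda>\<tau>. snd \<tau> = m \<and> fst \<tau> 6 \<le> u \<and> fst \<tau> 3 + fst \<tau> 6 * n = 1 + u * n \<and>
    (\<forall>x. x \<noteq> 3 \<and> x \<noteq> 6 \<longrightarrow> fst \<tau> x = \<rho> x)"
  have step: "runs row_step \<tau> 9 (\<lambda>\<tau>'. ?I \<tau>' \<and> fst \<tau>' 6 < fst \<tau> 6)"
    if I: "?I \<tau>" and nz: "val (Reg 6) \<tau> \<noteq> 0" for \<tau>
  proof -
    from nz obtain j where j: "fst \<tau> 6 = Suc j"
      by (cases "fst \<tau> 6") auto
    have "runs row_step \<tau> (time row_step) (\<lambda>\<tau>'. ?I \<tau>' \<and> fst \<tau>' 6 < fst \<tau> 6)"
      by (rule runs_straight) (use I j assms in \<open>auto simp: row_step_def\<close>)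
    then show ?thesis
      by (rule runs_mono) (simp_all add: row_step_def)
  qed
  have loop: "runs (While (Reg 6) row_step) \<tau> (11 * (n + 1)) ?Q"
    if "?I \<tau>" for \<tau>
  proof (rule runs_mono)
    show "runs (While (Reg 6) row_step) \<tau> ((fst \<tau> 6 + 1) * (1 + cost (Reg 6) + 9)) ?Q"
      by (rule runs_While[where I = ?I, OF that step]) auto
    show "(fst \<tau> 6 + 1) * (1 + cost (Reg 6) + 9) \<le> 11 * (n + 1)"
      using that assms by simp
  qed
  let ?init = "Seq (Assign 3 (Const 1)) (Assign 6 (Reg 8))"
  have init: "runs ?init (\<rho>, m) (time ?init) ?I"
    by (rule runs_straight) (use assms in auto)
  \<comment> \<open>17 is 1 for the sequencing, 5 for the initialisation and 11 for the loop with
    \<open>n = 0\<close>.\<close>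
  show ?thesis
    unfolding row_prog_def by (rule runs_mono[OF runs_Seq[OF init loop]]) simp_all
qed

lemma runs_scan_prog:
  assumes "input m" "i < n" "\<rho> 0 = N" "\<rho> 12 = n" "\<rho> 2 = i" "\<rho> 3 = 1 + num i * n"
    "0 < i \<Longrightarrow> \<rho> 4 = 1 + num (i - 1) * n"
  shows "runs (scan_prog st) (\<rho>, m) (75 * (n + 1))
    (\<lambda>\<tau>. snd \<tau> = m \<and> (fst \<tau> 7 \<noteq> 0 \<longleftrightarrow> cuts i) \<and> (\<forall>x. x \<notin> {6, 7, 9, 10, 11} \<longrightarrow> fst \<tau> x = \<rho> x))"
    (is "runs _ _ _ ?Q")
proof -
  let ?P = "\<lambda>r. (i < r \<and> A (i - 1) r \<and> \<not> A i r) \<or> (st \<and> r < i - 1 \<and> A i r \<and> \<not> A (i - 1) r)"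
  let ?I = "\<lambda>\<tau>. snd \<tau> = m \<and> fst \<tau> 6 \<le> n \<and> (fst \<tau> 7 \<noteq> 0 \<longleftrightarrow> i = 0 \<or> (\<exists>r<fst \<tau> 6. ?P r)) \<and>
    (\<forall>x. x \<notin> {6, 7, 9, 10, 11} \<longrightarrow> fst \<tau> x = \<rho> x)"
  \<comment> \<open>60 is rounded up from \<open>time (scan_step st)\<close>; the 64 below adds the
    4 steps of the guard.\<close>
  have step: "runs (scan_step st) \<tau> 60 (\<lambda>\<tau>'. ?I \<tau>' \<and> n - fst \<tau>' 6 < n - fst \<tau> 6)"
    if I: "?I \<tau>" and nz: "val (Sub (Reg 12) (Reg 6)) \<tau> \<noteq> 0" for \<tau>
  proof -
    define r where "r = fst \<tau> 6"
    have regs: "fst \<tau> 0 = N" "fst \<tau> 12 = n" "fst \<tau> 2 = i" "fst \<tau> 3 = 1 + num i * n"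
      "0 < i \<Longrightarrow> fst \<tau> 4 = 1 + num (i - 1) * n" "snd \<tau> = m" "fst \<tau> 6 = r"
      using I assms by (auto simp: r_def)
    have r: "r < n"
      using nz regs by simp
    have v: "m (Suc (n * n + r)) = num r"
      using assms(1) r by (simp add: input_def)
    have cur: "m (Suc (num i * n + num r)) = of_bool (A i r)"
      using assms(1,2) r by (simp add: input_def)
    have prev: "m (Suc (num (i - 1) * n + num r)) = of_bool (A (i - 1) r)"
      using assms(1,2) r by (simp add: input_def)
    define flag where "flag = (if ?P r then 1 else fst \<tau> 7)"
    have sem: "fst (sem (scan_step st) \<tau>) 7 = flag" if "0 < i"
      using that prev by (auto simp: scan_step_def regs v cur flag_def)
    \<comment> \<open>Register 4 is unconstrained at \<open>i = 0\<close>, so the entry read through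
      it is arbitrary; the flag is already raised and no step clears it.\<close>
    have sem0: "fst (sem (scan_step st) \<tau>) 7 \<noteq> 0" if "i = 0"
      using that I by (simp add: scan_step_def)
    have 7: "fst (sem (scan_step st) \<tau>) 7 \<noteq> 0 \<longleftrightarrow> i = 0 \<or> (\<exists>r'<Suc r. ?P r')"
    proof (cases "i = 0")
      case False
      then have "fst \<tau> 7 \<noteq> 0 \<longleftrightarrow> (\<exists>r'<r. ?P r')"
        using I by (simp add: r_def)
      then show ?thesis
        using False sem by (simp add: flag_def less_Suc_eq) blast
    qed (use sem0 in simp)
    have 6: "fst (sem (scan_step st) \<tau>) 6 = Suc r"
      by (simp add: scan_step_def regs)
    have fr: "snd (sem (scan_step st) \<tau>) = m"
      "\<forall>x. x \<notin> {6, 7, 9, 10, 11} \<longrightarrow> fst (sem (scan_step st) \<tau>) x = fst \<tau> x"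
      by (simp_all add: scan_step_def regs)
    have "runs (scan_step st) \<tau> (time (scan_step st)) (\<lambda>\<tau>'. ?I \<tau>' \<and> n - fst \<tau>' 6 < n - fst \<tau> 6)"
    proof (rule runs_straight)
      show "straight (scan_step st)"
        by (simp add: scan_step_def)
      show "?I (sem (scan_step st) \<tau>) \<and> n - fst (sem (scan_step st) \<tau>) 6 < n - fst \<tau> 6"
        unfolding 6 7 using fr I r by (auto simp: r_def)
    qed
    then show ?thesis
      by (rule runs_mono) (simp_all add: scan_step_def)
  qed
  have loop: "runs (While (Sub (Reg 12) (Reg 6)) (scan_step st)) \<tau> (64 * (n + 1)) ?Q"
    if "?I \<tau>" for \<tau>
  proof (rule runs_mono)
    show "runs (While (Sub (Reg 12) (Reg 6)) (scan_step st)) \<tau>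
        ((n - fst \<tau> 6 + 1) * (1 + cost (Sub (Reg 12) (Reg 6)) + 60)) ?Q"
    proof (rule runs_While[where I = ?I, OF that step])
      fix \<tau>' assume I: "?I \<tau>'" and z: "val (Sub (Reg 12) (Reg 6)) \<tau>' = 0"
      then have "fst \<tau>' 6 = n"
        using assms by simp
      with I show "?Q \<tau>'"
        by (simp add: cut_def)
    qed
  qed simp
  let ?init = "Seq (Assign 7 (Sub (Const 1) (Reg 2))) (Assign 6 (Const 0))"
  have init: "runs ?init (\<rho>, m) (time ?init) ?I"
    by (rule runs_straight) (use assms in auto)
  show ?thesis
    unfolding scan_prog_def by (rule runs_mono[OF runs_Seq[OF init loop]]) simp_all
qed

text \<open>Register 4 is described only once a position has been processed, as position 0 has no
  predecessor. The registers left out are recomputed in each iteration before they are read.\<close>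

definition main_inv :: "state \<Rightarrow> bool" where
  "main_inv \<tau> \<longleftrightarrow> fst \<tau> 0 = N \<and> fst \<tau> 12 = n \<and> fst \<tau> 2 \<le> n \<and> fst \<tau> 5 = count cuts (fst \<tau> 2) \<and>
     (0 < fst \<tau> 2 \<longrightarrow> fst \<tau> 4 = 1 + num (fst \<tau> 2 - 1) * n) \<and> input (snd \<tau>) \<and>
     (\<forall>j<fst \<tau> 2. snd \<tau> (N + num j) = count cuts (Suc j) - 1)"

lemma runs_main_step:
  assumes inv: "main_inv \<sigma>" and less: "fst \<sigma> 2 < n"
  shows "runs (main_step st) \<sigma> (150 * (n + 1)) (\<lambda>\<tau>. main_inv \<tau> \<and> n - fst \<tau> 2 < n - fst \<sigma> 2)"
    (is "runs _ _ _ ?Q")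
proof -
  define i where "i = fst \<sigma> 2"
  have regs: "fst \<sigma> 0 = N" "fst \<sigma> 12 = n" "fst \<sigma> 2 = i" "fst \<sigma> 5 = count cuts i" "i < n"
    "0 < i \<Longrightarrow> fst \<sigma> 4 = 1 + num (i - 1) * n" "input (snd \<sigma>)"
    and labels: "\<forall>j<i. snd \<sigma> (N + num j) = count cuts (Suc j) - 1"
    using inv less unfolding main_inv_def i_def by blast+
  have v: "snd \<sigma> (Suc (n * n + i)) = num i"
    using regs by (simp add: input_def)
  let ?\<rho> = "(fst \<sigma>)(8 := num i)"
  let ?R = "\<lambda>\<tau>. snd \<tau> = snd \<sigma> \<and> fst \<tau> 3 = 1 + num i * n \<and>
    (\<forall>x. x \<noteq> 3 \<and> x \<noteq> 6 \<longrightarrow> fst \<tau> x = ?\<rho> x)"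
  let ?S = "\<lambda>\<tau>. snd \<tau> = snd \<sigma> \<and> (fst \<tau> 7 \<noteq> 0 \<longleftrightarrow> cuts i) \<and> fst \<tau> 3 = 1 + num i * n \<and>
    (\<forall>x. x \<notin> {3, 6, 7, 9, 10, 11} \<longrightarrow> fst \<tau> x = ?\<rho> x)"
  have 1: "runs fetch \<sigma> (time fetch) (\<lambda>\<tau>. \<tau> = (?\<rho>, snd \<sigma>))"
    by (rule runs_straight) (simp_all add: fetch_def regs v)
  have 2: "runs row_prog \<tau> (17 * (n + 1)) ?R" if "\<tau> = (?\<rho>, snd \<sigma>)" for \<tau>
    unfolding that by (rule runs_row_prog) (use regs num_less[of i] in auto)
  have 3: "runs (scan_prog st) \<tau> (75 * (n + 1)) ?S" if R: "?R \<tau>" for \<tau>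
  proof -
    have "runs (scan_prog st) (fst \<tau>, snd \<tau>) (75 * (n + 1))
      (\<lambda>\<upsilon>. snd \<upsilon> = snd \<tau> \<and> (fst \<upsilon> 7 \<noteq> 0 \<longleftrightarrow> cuts i) \<and>
        (\<forall>x. x \<notin> {6, 7, 9, 10, 11} \<longrightarrow> fst \<upsilon> x = fst \<tau> x))"
      by (rule runs_scan_prog) (use R regs in auto)
    then have "runs (scan_prog st) \<tau> (75 * (n + 1))
      (\<lambda>\<upsilon>. snd \<upsilon> = snd \<tau> \<and> (fst \<upsilon> 7 \<noteq> 0 \<longleftrightarrow> cuts i) \<and>
        (\<forall>x. x \<notin> {6, 7, 9, 10, 11} \<longrightarrow> fst \<upsilon> x = fst \<tau> x))"
      by simp
    then show ?thesis
      by (rule runs_mono) (use R in auto)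
  qed
  have 4: "runs finish \<tau> (time finish) ?Q" if S: "?S \<tau>" for \<tau>
  proof (rule runs_straight)
    have \<tau>: "fst \<tau> 0 = N" "fst \<tau> 12 = n" "fst \<tau> 2 = i" "fst \<tau> 5 = count cuts i"
      "fst \<tau> 8 = num i" "fst \<tau> 3 = 1 + num i * n" "snd \<tau> = snd \<sigma>" "fst \<tau> 7 \<noteq> 0 \<longleftrightarrow> cuts i"
      using S regs by auto
    let ?\<tau> = "sem finish \<tau>"
    have mem: "snd ?\<tau> = (snd \<sigma>)(N + num i := count cuts (Suc i) - 1)"
      using \<tau> by (simp add: finish_def)
    have r: "fst ?\<tau> 0 = N" "fst ?\<tau> 12 = n" "fst ?\<tau> 2 = Suc i" "fst ?\<tau> 5 = count cuts (Suc i)"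
      "fst ?\<tau> 4 = 1 + num i * n"
      using \<tau> by (simp_all add: finish_def)
    \<comment> \<open>Injectivity of \<open>num\<close> keeps the new label from overwriting an
      earlier one.\<close>
    have "snd ?\<tau> (N + num j) = count cuts (Suc j) - 1" if "j < Suc i" for j
      using that labels regs num_eq_iff[of j i]
      by (cases "j = i") (simp_all add: mem del: count_Suc)
    then show "?Q ?\<tau>"
      using r regs input_upd[OF regs(7)] by (simp add: main_inv_def mem del: count_Suc)
  qed (simp add: finish_def)
  show ?thesis
    unfolding main_step_def
    by (rule runs_mono[OF runs_Seq[OF 1 runs_Seq[OF 2 runs_Seq[OF 3 4]]]])
      (simp_all add: fetch_def finish_def)
qed

lemma runs_main_loop:
  assumes "main_inv \<sigma>"
  shows "runs (While (Sub (Reg 12) (Reg 2)) (main_step st)) \<sigma> (154 * (n + 1) * (n + 1))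
    (\<lambda>\<tau>. main_inv \<tau> \<and> fst \<tau> 2 = n)"
proof (rule runs_mono)
  show "runs (While (Sub (Reg 12) (Reg 2)) (main_step st)) \<sigma>
      ((n - fst \<sigma> 2 + 1) * (1 + cost (Sub (Reg 12) (Reg 2)) + 150 * (n + 1)))
      (\<lambda>\<tau>. main_inv \<tau> \<and> fst \<tau> 2 = n)"
  proof (rule runs_While[where I = main_inv, OF assms])
    fix \<tau> assume "main_inv \<tau>" "val (Sub (Reg 12) (Reg 2)) \<tau> \<noteq> 0"
    then show "runs (main_step st) \<tau> (150 * (n + 1)) (\<lambda>\<upsilon>. main_inv \<upsilon> \<and> n - fst \<upsilon> 2 < n - fst \<tau> 2)"
      by (intro runs_main_step) (auto simp: main_inv_def)
  qed (auto simp: main_inv_def)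
  \<comment> \<open>The 4 steps of the guard are absorbed:
    \<open>4 + 150 * (n + 1) \<le> 154 * (n + 1)\<close>.\<close>
  have "(n - fst \<sigma> 2 + 1) * (1 + cost (Sub (Reg 12) (Reg 2)) + 150 * (n + 1))
      \<le> (n + 1) * (154 * (n + 1))"
    by (rule mult_mono) auto
  then show "(n - fst \<sigma> 2 + 1) * (1 + cost (Sub (Reg 12) (Reg 2)) + 150 * (n + 1))
      \<le> 154 * (n + 1) * (n + 1)"
    by (simp only: mult_ac)
qed

lemma runs_copy_loop:
  assumes "main_inv \<sigma>" "fst \<sigma> 2 = n" "fst \<sigma> 6 = 0"
  shows "runs (While (Sub (Reg 12) (Reg 6)) copy_step) \<sigma> (24 * (n + 1))
    (\<lambda>\<tau>. fst \<tau> 12 = n \<and> fst \<tau> 5 = count cuts n \<and>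
      (\<forall>i<n. snd \<tau> (1 + num i) = count cuts (Suc i) - 1))"
    (is "runs _ _ _ ?Q")
proof (rule runs_mono)
  let ?I = "\<lambda>\<tau>. fst \<tau> 0 = N \<and> fst \<tau> 12 = n \<and> fst \<tau> 5 = count cuts n \<and> fst \<tau> 6 \<le> n \<and>
    (\<forall>v<n. snd \<tau> (N + v) = snd \<sigma> (N + v)) \<and> (\<forall>v<fst \<tau> 6. snd \<tau> (1 + v) = snd \<sigma> (N + v))"
  show "runs (While (Sub (Reg 12) (Reg 6)) copy_step) \<sigma>
      ((n - fst \<sigma> 6 + 1) * (1 + cost (Sub (Reg 12) (Reg 6)) + 20)) ?Q"
  proof (rule runs_While[where I = ?I])
    show "?I \<sigma>"
      using assms by (simp add: main_inv_def)
  next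
    fix \<tau> assume I: "?I \<tau>" and nz: "val (Sub (Reg 12) (Reg 6)) \<tau> \<noteq> 0"
    have "runs copy_step \<tau> (time copy_step) (\<lambda>\<upsilon>. ?I \<upsilon> \<and> n - fst \<upsilon> 6 < n - fst \<tau> 6)"
      by (rule runs_straight) (use I nz in \<open>auto simp: copy_step_def less_Suc_eq\<close>)
    then show "runs copy_step \<tau> 20 (\<lambda>\<upsilon>. ?I \<upsilon> \<and> n - fst \<upsilon> 6 < n - fst \<tau> 6)"
      by (rule runs_mono) (simp_all add: copy_step_def)
  next
    fix \<tau> assume I: "?I \<tau>" and "val (Sub (Reg 12) (Reg 6)) \<tau> = 0"
    then have "snd \<tau> (1 + num i) = snd \<sigma> (N + num i)" if "i < n" for i
      using num_less[OF that] by simp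
    with I assms(1,2) show "?Q \<tau>"
      unfolding main_inv_def by metis
  qed
qed (simp_all add: assms)

lemma runs_main_prog:
  assumes "input m"
  shows "runs (main_prog st) ((\<lambda>_. 0)(0 := N), m) (250 * (n + 1) * (n + 1))
    (\<lambda>\<tau>. fst \<tau> 0 = Suc n \<and> snd \<tau> 0 = count cuts n \<and>
      (\<forall>i<n. snd \<tau> (Suc (num i)) = count cuts (Suc i) - 1))"
    (is "runs _ ?\<sigma> _ ?Q")
proof -
  have 1: "runs (Assign 12 (Mem (Const 0))) ?\<sigma> (time (Assign 12 (Mem (Const 0)))) main_inv"
    by (rule runs_straight) (use assms in \<open>auto simp: main_inv_def input_def\<close>)
  have 2: "runs (Assign 6 (Const 0)) \<tau> (time (Assign 6 (Const 0)))
      (\<lambda>\<tau>. main_inv \<tau> \<and> fst \<tau> 2 = n \<and> fst \<tau> 6 = 0)"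
    if "main_inv \<tau> \<and> fst \<tau> 2 = n" for \<tau>
    by (rule runs_straight) (use that in \<open>auto simp: main_inv_def\<close>)
  let ?last = "Seq (Store (Const 0) (Reg 5)) (Assign 0 (Add (Reg 12) (Const 1)))"
  have 3: "runs ?last \<tau> (time ?last) ?Q"
    if "fst \<tau> 12 = n \<and> fst \<tau> 5 = count cuts n \<and>
      (\<forall>i<n. snd \<tau> (1 + num i) = count cuts (Suc i) - 1)" for \<tau>
    by (rule runs_straight) (use that in auto)
  show ?thesis
    unfolding main_prog_def
    by (rule runs_mono[OF runs_Seq[OF 1 runs_Seq[OF runs_main_loop
          runs_Seq[OF 2 runs_Seq[OF runs_copy_loop 3]]]]])
      (auto simp: algebra_simps)
qed

end


section \<open>Instances and solutions\<close>

lemma length_concat_uniform: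
  "(\<And>x. x \<in> set xs \<Longrightarrow> length (f x) = k) \<Longrightarrow> length (concat (map f xs)) = length xs * k"
  by (induction xs) auto

lemma nth_concat_uniform:
  assumes "\<And>x. x \<in> set xs \<Longrightarrow> length (f x) = k" "i < length xs" "j < k"
  shows "concat (map f xs) ! (i * k + j) = f (xs ! i) ! j"
  using assms
proof (induction xs arbitrary: i)
  case (Cons x xs)
  show ?case
  proof (cases i)
    case 0
    then show ?thesis
      using Cons.prems by (simp add: nth_append)
  next
    case (Suc i')
    then show ?thesis
      using Cons.prems Cons.IH[of i'] by (simp add: nth_append)
  qed
qed simp

declare ordered_graph_code.simps [simp del]

locale graph_instance = ordering G s st
  for G :: "'a pair_pre_digraph" and s and st +
  fixes vs :: "'a list"
  assumes vs: "vs \<in> permutations_of_set (pverts G)"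
begin

lemma dist_vs: "distinct vs" and set_vs: "set vs = pverts G"
  using vs by (auto simp: permutations_of_set_def)

lemma length_vs: "length vs = n"
  using dist_vs dist set_vs set_s by (metis distinct_card)

definition num :: "nat \<Rightarrow> nat" where
  "num i = vertex_number vs (s ! i)"

lemma bij_vs: "bij_betw ((!) vs) {..<n} (pverts G)"
  using bij_betw_nth[OF dist_vs refl set_vs[symmetric]] length_vs by simp

lemma bij_s: "bij_betw ((!) s) {..<n} (pverts G)"
  using bij_betw_nth[OF dist refl set_s[symmetric]] .

lemma nth_num: "i < n \<Longrightarrow> vs ! num i = s ! i"
  using bij_betw_inv_into_right[OF bij_vs] bij_s length_vs
  by (auto simp: num_def vertex_number_def bij_betw_def)

sublocale encoding n num "\<lambda>i j. A i j" st
proof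
  have "bij_betw (inv_into {..<n} ((!) vs) \<circ> (!) s) {..<n} {..<n}"
    using bij_s bij_betw_inv_into[OF bij_vs] by (rule bij_betw_trans)
  then show "bij_betw num {..<n} {..<n}"
    by (simp add: num_def vertex_number_def length_vs comp_def cong: bij_betw_cong)
qed

abbreviation "code \<equiv> ordered_graph_code (G, vs, s)"

lemma length_code: "length code = N"
  by (simp add: ordered_graph_code.simps length_concat_uniform[where k = n] length_vs)

lemma initial_code: "initial_state code = ((\<lambda>_. 0)(0 := N), snd (initial_state code))"
  unfolding initial_state_def length_code by simp

lemma input_code: "input (snd (initial_state code))"
proof -
  let ?rows = "concat (map (\<lambda>u. map (\<lambda>v. of_bool ((u, v) \<in> parcs G)) vs) vs) :: nat list"
  have code: "code = n # ?rows @ map (vertex_number vs) s"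
    by (simp add: ordered_graph_code.simps length_vs)
  have len: "length ?rows = n * n"
    by (simp add: length_concat_uniform[where k = n] length_vs)
  have mem: "snd (initial_state code) i = code ! i" if "i < N" for i
    using that by (simp only: initial_state_def length_code snd_conv if_True)
  have order: "code ! (1 + n * n + i) = num i" if "i < n" for i
    using that by (simp add: code nth_append len num_def)
  have row: "code ! (1 + num i * n + num j) = of_bool (A i j)"
    and row_less: "num i * n + num j < n * n"
    if "i < n" "j < n" for i j
  proof -
    \<comment> \<open>Row \<open>num i\<close> ends inside the matrix, so the lookup in the appended
      list stays within \<open>?rows\<close>.\<close>
    have "(num i + 1) * n \<le> n * n"
      using num_less[OF that(1)] by (intro mult_right_mono) auto
    then show less: "num i * n + num j < n * n"
      using num_less[OF that(2)] by simp
    have "?rows ! (num i * n + num j) = map (\<lambda>v. of_bool ((vs ! num i, v) \<in> parcs G)) vs ! num j"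
      by (rule nth_concat_uniform) (simp_all add: length_vs num_less that)
    then have "?rows ! (num i * n + num j) = of_bool (A i j)"
      using that by (simp add: length_vs num_less nth_num)
    then show "code ! (1 + num i * n + num j) = of_bool (A i j)"
      using less by (simp add: code nth_append len)
  qed
  show ?thesis
    unfolding input_def
  proof (intro conjI allI impI)
    show "snd (initial_state code) 0 = n"
      using mem[of 0] by (simp add: code)
    show "snd (initial_state code) (1 + n * n + i) = num i" if "i < n" for i
      using mem[of "1 + n * n + i"] order that by simp
    show "snd (initial_state code) (1 + num i * n + num j) = of_bool (A i j)"
      if "i < n" "j < n" for i j
      using mem[of "1 + num i * n + num j"] row[OF that] row_less[OF that] by simp
  qed
qed

section \<open>From the final memory to a minimum partition\<close>

lemma codes_partition_blocks:
  assumes out: "fst \<tau> 0 = Suc n" "snd \<tau> 0 = count C n"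
    "\<And>i. i < n \<Longrightarrow> snd \<tau> (Suc (num i)) = count C (Suc i) - 1"
  shows "codes_partition vs blocks (output_word \<tau>)"
proof -
  define ls where "ls = map (\<lambda>v. snd \<tau> (Suc v)) [0..<n]"
  have "output_word \<tau> = count C n # ls"
    unfolding output_word_def out(1) ls_def
    by (simp add: upt_conv_Cons map_Suc_upt[symmetric] out(2) del: upt_Suc)
  moreover have length: "length ls = n"
    by (simp add: ls_def)
  have nth: "ls ! num i = count C (Suc i) - 1" if "i < n" for i
    using num_less[OF that] out(3)[OF that] by (simp add: ls_def del: count_Suc)
  have "set ls \<subseteq> {..<count C n}"
  proof
    fix l assume "l \<in> set ls"
    then obtain v where "v < n" "l = ls ! v"
      using length by (metis in_set_conv_nth)
    then obtain i where "i < n" "l = ls ! num i"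
      using num_surj by blast
    then show "l \<in> {..<count C n}"
      using label_less[of i] nth by (simp del: count_Suc)
  qed
  moreover have "{vs ! v |v. v < n \<and> ls ! v = j} = block j" for j
  proof -
    \<comment> \<open>Under truncated subtraction a count of 0 would also yield label 0; the cut at
      position 0 excludes it.\<close>
    have *: "ls ! num i = j \<longleftrightarrow> count C (Suc i) = Suc j" if "i < n" for i
      using count_pos[of C i] nth[OF that] by (simp add: cut_def del: count_Suc) linarith
    show ?thesis
      unfolding block_def
    proof (intro equalityI subsetI; elim CollectE exE conjE)
      fix x v assume "x = vs ! v" "v < n" "ls ! v = j"
      moreover from this num_surj obtain i where "i < n" "v = num i"
        by blast
      ultimately show "x \<in> {s ! i |i. i < n \<and> count C (Suc i) = Suc j}"
        using * nth_num by (auto simp del: count_Suc)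
    next
      fix x i assume "x = s ! i" "i < n" "count C (Suc i) = Suc j"
      then show "x \<in> {vs ! v |v. v < n \<and> ls ! v = j}"
        using *[of i] nth_num[of i] num_less[of i]
        by (intro CollectI exI[of _ "num i"]) (simp del: count_Suc)
    qed
  qed
  ultimately show ?thesis
    unfolding codes_partition_def
    by (intro exI[of _ "count C n"] exI[of _ ls])
      (simp add: length length_vs card_blocks blocks_def[symmetric])
qed

lemma main_prog_solves:
  "\<exists>t \<tau>. exec (main_prog st) (initial_state code) t \<tau> \<and> t \<le> 250 * (length code + 1) ^ 2 \<and>
     codes_minimum_partition (prec st) (G, vs, s) (output_word \<tau>)"
proof -
  from runs_main_prog[OF input_code] obtain t \<tau> where
    run: "exec (main_prog st) (initial_state code) t \<tau>" "t \<le> 250 * (n + 1) * (n + 1)" and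
    out: "fst \<tau> 0 = Suc n" "snd \<tau> 0 = count C n"
      "\<forall>i<n. snd \<tau> (Suc (num i)) = count C (Suc i) - 1"
    unfolding runs_def initial_code[symmetric] by blast
  \<comment> \<open>The code has length \<open>1 + n * n + n\<close>, so the time is even linear in
    it; the crude estimate \<open>n \<le> length code\<close> is enough here.\<close>
  have "(n + 1) * (n + 1) \<le> (length code + 1) * (length code + 1)"
    unfolding length_code by (intro mult_mono) auto
  with run(2) have "t \<le> 250 * (length code + 1) ^ 2"
    by (simp only: power2_eq_square mult.assoc)
  moreover have "codes_partition vs blocks (output_word \<tau>)"
    using out by (intro codes_partition_blocks) auto
  ultimately show ?thesis
    using run(1) is_arg_min_blocks unfolding codes_minimum_partition.simps by blast
qed

end

lemma poly_time_solvable_prec: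
  "poly_time_solvable (ordered_graphs :: 'a ordered_graph set) ordered_graph_code
     (codes_minimum_partition (prec st))"
  unfolding poly_time_solvable_def
\<comment> \<open>Program and polynomial become schematic before \<open>x\<close> is fixed and so
  cannot depend on the instance; the concluding \<open>show\<close> instantiates them.\<close>
proof (rule exI, rule exI, rule ballI)
  fix x :: "'a ordered_graph"
  assume "x \<in> ordered_graphs"
  then obtain G vs s where x: "x = (G, vs, s)" "pair_graph G"
    "vs \<in> permutations_of_set (pverts G)" "s \<in> permutations_of_set (pverts G)"
    by (auto simp: ordered_graphs_def)
  then interpret graph_instance G s st vs
    by (intro graph_instance.intro graph_instance_axioms.intro ordering.intro)
  have "poly ([:250:] * [:1, 1:] ^ 2) (length code) = 250 * (length code + 1) ^ 2"
    by (simp only: poly_mult poly_power) (simp add: add.commute)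
  then show "\<exists>t \<tau>. exec (main_prog st) (initial_state (ordered_graph_code x)) t \<tau> \<and>
      t \<le> poly ([:250:] * [:1, 1:] ^ 2) (length (ordered_graph_code x)) \<and>
      codes_minimum_partition (prec st) x (output_word \<tau>)"
    using main_prog_solves unfolding x(1) by metis
qed

theorem theorem5:
  "poly_time_solvable (ordered_graphs :: 'a ordered_graph set) ordered_graph_code
     (codes_minimum_partition precedence_consistent) \<and>
   poly_time_solvable (ordered_graphs :: 'a ordered_graph set) ordered_graph_code
     (codes_minimum_partition precedence_strongly_consistent)"
  using poly_time_solvable_prec[of False] poly_time_solvable_prec[of True]
  by (simp add: prec_def)

end
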